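(* $\mathbf{GR}^-$ enjoys uniform interpolation property: for every $\mathcal{L}_2$-formula $A$ and every finite set $P$ of propositional variables there is an $\mathcal{L}_2$-formula $C$ such that (1) $v(C)\subseteq v(A)\setminus P$; (2) $\mathbf{GR}^-\vdash A\to C$; (3) for every $\mathcal{L}_2$-formula $B$, if $\mathbf{GR}^-\vdash A\to B$ and $v(B)\cap P=\emptyset$, then $\mathbf{GR}^-\vdash C\to B$.
   Context: $\mathcal{L}_2$ is the bimodal propositional language with countably many propositional variables, $\bot$, connectives $\neg,\vee$ (others defined), and unary modal operators $\Box,\blacksquare$; $\Diamond$ abbreviates $\neg\Box\neg$; $v(A)$ denotes the set of propositional variables occurring in $A$. The logic $\mathbf{GR}^-$ has as axioms all propositional tautologies of $\mathcal{L}_2$ and all instances of $\Box(A\to B)\to(\Box A\to\Box B)$, $\Box(\Box A\to A)\to\Box A$, $\blacksquare A\to\Box A$, $\Box A\to\Box\blacksquare A$, $\Box A\to(\Box\bot\vee\blacksquare A)$, $\Diamond\blacksquare A\to\Diamond A$, and rules modus ponens and $\Box$-necessitation (from $A$ infer $\Box A$). *)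

theory Defs
  imports Main
begin

datatype fm =
    Var nat
  | Bot  ("\<^bold>\<bottom>")
  | Neg fm  ("\<^bold>\<not> _" [70] 70)
  | Dis fm fm  (infixr "\<^bold>\<or>" 60)
  | Box fm  ("\<^bold>\<box> _" [70] 70)
  | BBox fm  ("\<^bold>\<sqdot> _" [70] 70)  (* the black box *)

abbreviation Imp :: "fm \<Rightarrow> fm \<Rightarrow> fm"  (infixr "\<^bold>\<longrightarrow>" 55)
  where "A \<^bold>\<longrightarrow> B \<equiv> (\<^bold>\<not> A) \<^bold>\<or> B"

abbreviation Dia :: "fm \<Rightarrow> fm"  ("\<^bold>\<diamond> _" [70] 70)
  where "\<^bold>\<diamond> A \<equiv> \<^bold>\<not> (\<^bold>\<box> (\<^bold>\<not> A))"

primrec vars :: "fm \<Rightarrow> nat set"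
  where
    "vars (Var p) = {p}"
  | "vars \<^bold>\<bottom> = {}"
  | "vars (\<^bold>\<not> A) = vars A"
  | "vars (A \<^bold>\<or> B) = vars A \<union> vars B"
  | "vars (\<^bold>\<box> A) = vars A"
  | "vars (\<^bold>\<sqdot> A) = vars A"

(* Boolean evaluation in which, besides the variables, every formula of the form Box A or
   BBox A is an atom with an arbitrary truth value; a formula true under all such
   evaluations is exactly a substitution instance of a classical propositional tautology. *)
primrec peval :: "(fm \<Rightarrow> bool) \<Rightarrow> fm \<Rightarrow> bool"
  where
    "peval e (Var p) = e (Var p)"
  | "peval e \<^bold>\<bottom> = False"
  | "peval e (\<^bold>\<not> A) = (\<not> peval e A)"
  | "peval e (A \<^bold>\<or> B) = (peval e A \<or> peval e B)"
  | "peval e (\<^bold>\<box> A) = e (\<^bold>\<box> A)"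
  | "peval e (\<^bold>\<sqdot> A) = e (\<^bold>\<sqdot> A)"

definition tautology :: "fm \<Rightarrow> bool"
  where "tautology A \<longleftrightarrow> (\<forall>e. peval e A)"

inductive GR_minus :: "fm \<Rightarrow> bool"  ("GR\<^sup>- \<turnstile> _" [50] 50)
  where
    Taut: "tautology A \<Longrightarrow> GR\<^sup>- \<turnstile> A"
  | K: "GR\<^sup>- \<turnstile> \<^bold>\<box> (A \<^bold>\<longrightarrow> B) \<^bold>\<longrightarrow> (\<^bold>\<box> A \<^bold>\<longrightarrow> \<^bold>\<box> B)"
  | Loeb: "GR\<^sup>- \<turnstile> \<^bold>\<box> (\<^bold>\<box> A \<^bold>\<longrightarrow> A) \<^bold>\<longrightarrow> \<^bold>\<box> A"
  | BBox_Box: "GR\<^sup>- \<turnstile> \<^bold>\<sqdot> A \<^bold>\<longrightarrow> \<^bold>\<box> A"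
  | Box_Box_BBox: "GR\<^sup>- \<turnstile> \<^bold>\<box> A \<^bold>\<longrightarrow> \<^bold>\<box> (\<^bold>\<sqdot> A)"
  | Box_BBox: "GR\<^sup>- \<turnstile> \<^bold>\<box> A \<^bold>\<longrightarrow> (\<^bold>\<box> \<^bold>\<bottom> \<^bold>\<or> \<^bold>\<sqdot> A)"
  | Dia_BBox: "GR\<^sup>- \<turnstile> \<^bold>\<diamond> (\<^bold>\<sqdot> A) \<^bold>\<longrightarrow> \<^bold>\<diamond> A"
  | MP: "GR\<^sup>- \<turnstile> A \<^bold>\<longrightarrow> B \<Longrightarrow> GR\<^sup>- \<turnstile> A \<Longrightarrow> GR\<^sup>- \<turnstile> B"
  | Nec: "GR\<^sup>- \<turnstile> A \<Longrightarrow> GR\<^sup>- \<turnstile> \<^bold>\<box> A"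

end

theory Submission
  imports Defs
begin

text \<open>
  In a transitive, conversely well-founded Kripke model of this logic the black box coincides with
  the box at non-terminal worlds, while at a terminal world each formula with outermost black box is
  an independent atom, constrained only by the axioms relating it to the worlds below. The uniform
  interpolant of \<open>A\<close> is the disjunction of the characteristic formulas, up to a sufficient modal
  depth and over the atoms of \<open>A\<close> free of \<open>P\<close>, of all pointed models of \<open>A\<close>. It implies every
  \<open>B\<close> as required because of Visser's amalgamation: if a pointed model of \<open>A\<close> and another pointed
  model are bisimilar to depth \<open>2d + 1\<close>, where \<open>d\<close> is the number of boxed formulas in the closure
  of \<open>A\<close> that fail at the first point, then a submodel of pairs satisfies \<open>A\<close> and is fully
  bisimilar to the second model with respect to the formulas free of \<open>P\<close>.
\<close>

section \<open>Semantics\<close>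

text \<open>At terminal worlds only the black boxes of formulas in \<open>S\<close> are valued by \<open>e\<close>. All others get
  the value of their argument, which always meets the constraints, so a model only has to be
  specified on the formulas one cares about.\<close>

primrec sat :: "('w \<Rightarrow> 'w \<Rightarrow> bool) \<Rightarrow> ('w \<Rightarrow> fm \<Rightarrow> bool) \<Rightarrow> fm set \<Rightarrow> 'w \<Rightarrow> fm \<Rightarrow> bool"
  where
    "sat R e S w (Var p) = e w (Var p)"
  | "sat R e S w \<^bold>\<bottom> = False"
  | "sat R e S w (\<^bold>\<not> A) = (\<not> sat R e S w A)"
  | "sat R e S w (A \<^bold>\<or> B) = (sat R e S w A \<or> sat R e S w B)"
  | "sat R e S w (\<^bold>\<box> A) = (\<forall>v. R w v \<longrightarrow> sat R e S v A)"
  | "sat R e S w (\<^bold>\<sqdot> A) =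
      (if \<exists>v. R w v then \<forall>v. R w v \<longrightarrow> sat R e S v A
       else if A \<in> S then e w (\<^bold>\<sqdot> A) else sat R e S w A)"

text \<open>The last clause is what the axioms \<open>Box_Box_BBox\<close> and
  \<open>Dia_BBox\<close> demand of the valuation at terminal worlds; at all other worlds they
  follow from transitivity.\<close>

definition rosser_model :: "('w \<Rightarrow> 'w \<Rightarrow> bool) \<Rightarrow> ('w \<Rightarrow> fm \<Rightarrow> bool) \<Rightarrow> fm set \<Rightarrow> bool"
  where "rosser_model R e S \<longleftrightarrow> transp R \<and> wfp R\<inverse>\<inverse> \<and>
    (\<forall>w t D. R w t \<longrightarrow> (\<nexists>u. R t u) \<longrightarrow> D \<in> S \<longrightarrow>
      ((\<forall>v. R w v \<longrightarrow> sat R e S v D) \<longrightarrow> e t (\<^bold>\<sqdot> D)) \<and>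
      ((\<forall>v. R w v \<longrightarrow> \<not> sat R e S v D) \<longrightarrow> \<not> e t (\<^bold>\<sqdot> D)))"

lemma rosser_model_transD: "rosser_model R e S \<Longrightarrow> R u v \<Longrightarrow> R v w \<Longrightarrow> R u w"
  unfolding rosser_model_def by (blast dest: transpD)

text \<open>Successors of \<open>t\<close> are successors of \<open>w\<close> by transitivity. If
  there are none, either the valuation is constrained or the default value is that of
  \<open>D\<close> at \<open>t\<close>, itself a successor of \<open>w\<close>.\<close>

lemma sat_BBox_if_Box_below:
  assumes "rosser_model R e S" "R w t" "\<And>v. R w v \<Longrightarrow> sat R e S v D"
  shows "sat R e S t (\<^bold>\<sqdot> D)"
proof (cases "\<exists>u. R t u")
  case True
  then show ?thesis using assms rosser_model_transD[OF assms(1,2)] by auto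
next
  case False
  then show ?thesis using assms unfolding rosser_model_def by auto
qed

lemma not_sat_BBox_if_Box_Neg_below:
  assumes "rosser_model R e S" "R w t" "\<And>v. R w v \<Longrightarrow> \<not> sat R e S v D"
  shows "\<not> sat R e S t (\<^bold>\<sqdot> D)"
proof (cases "\<exists>u. R t u")
  case True
  then show ?thesis using assms rosser_model_transD[OF assms(1,2)] by auto
next
  case False
  then show ?thesis using assms unfolding rosser_model_def by auto
qed

text \<open>Converse well-foundedness supplies a last world where \<open>A\<close> fails. This
  yields Loeb's axiom and, in the amalgamation, steps along which a new box becomes true.\<close>

lemma sat_Box_last_counterexample:
  assumes "rosser_model R e S" "\<not> sat R e S w (\<^bold>\<box> A)"
  obtains v where "R w v" "\<not> sat R e S v A" "sat R e S v (\<^bold>\<box> A)"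
proof -
  obtain v where v: "R w v" "\<not> sat R e S v A" using assms(2) by auto
  have "wfp R\<inverse>\<inverse>" using assms(1) by (simp add: rosser_model_def)
  then obtain z where z: "z \<in> {v. R w v \<and> \<not> sat R e S v A}"
    "\<And>y. R\<inverse>\<inverse> y z \<Longrightarrow> y \<notin> {v. R w v \<and> \<not> sat R e S v A}"
    using v unfolding wfp_eq_minimal by (blast dest: spec[of _ "{v. R w v \<and> \<not> sat R e S v A}"])
  show thesis using that[of z] z rosser_model_transD[OF assms(1)] by fastforce
qed

lemma sat_BBox_nonterminal: "R w u \<Longrightarrow> sat R e S w (\<^bold>\<sqdot> D) = sat R e S w (\<^bold>\<box> D)"
  by auto

lemma sat_eq_peval: "sat R e S w A = peval (sat R e S w) A"
  by (induction A) auto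

theorem soundness:
  assumes "GR\<^sup>- \<turnstile> A" "rosser_model R e S"
  shows "sat R e S w A"
  using assms(1)
proof (induction arbitrary: w)
  case (Taut A)
  then show ?case using sat_eq_peval[of R e S w A] by (simp add: tautology_def)
next
  case (Loeb A)
  show ?case
  proof (cases "sat R e S w (\<^bold>\<box> A)")
    case False
    then obtain v where "R w v" "\<not> sat R e S v A" "sat R e S v (\<^bold>\<box> A)"
      by (rule sat_Box_last_counterexample[OF assms(2)])
    then show ?thesis by auto
  qed simp
next
  case (Box_Box_BBox A)
  show ?case by (auto simp del: sat.simps(6) intro: sat_BBox_if_Box_below[OF assms(2)])
next
  case (Dia_BBox A)
  show ?case using not_sat_BBox_if_Box_Neg_below[OF assms(2)] by (auto simp del: sat.simps(6))
\<comment> \<open>\<open>BBox_Box\<close> and \<open>Box_BBox\<close> are trivial at terminal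
  worlds, because every box, even that of \<open>Bot\<close>, holds there.\<close>
qed auto

section \<open>Maximal consistent sets\<close>

abbreviation imps :: "fm list \<Rightarrow> fm \<Rightarrow> fm"
  where "imps xs A \<equiv> foldr (\<^bold>\<longrightarrow>) xs A"

lemma peval_imps: "peval e (imps xs A) \<longleftrightarrow> ((\<forall>x\<in>set xs. peval e x) \<longrightarrow> peval e A)"
  by (induction xs) auto

lemma GR_imps_MP: "GR\<^sup>- \<turnstile> imps xs A \<Longrightarrow> \<forall>x\<in>set xs. GR\<^sup>- \<turnstile> x \<Longrightarrow> GR\<^sup>- \<turnstile> A"
  by (induction xs) (auto dest: MP)

lemma GR_taut_consequence:
  assumes "\<forall>x\<in>set xs. GR\<^sup>- \<turnstile> x" "\<And>e. \<forall>x\<in>set xs. peval e x \<Longrightarrow> peval e A"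
  shows "GR\<^sup>- \<turnstile> A"
  using assms GR_imps_MP[of xs A] Taut[of "imps xs A"] by (auto simp: tautology_def peval_imps)

text \<open>Premises enter only as antecedents of a theorem, so necessitation never applies to them
  and the deduction theorem is purely propositional.\<close>

definition ded :: "fm set \<Rightarrow> fm \<Rightarrow> bool"
  where "ded \<Gamma> A \<longleftrightarrow> (\<exists>xs. set xs \<subseteq> \<Gamma> \<and> GR\<^sup>- \<turnstile> imps xs A)"

lemma ded_taut_consequence:
  assumes "\<forall>x\<in>set ys. ded \<Gamma> x" "\<And>e. \<forall>x\<in>set ys. peval e x \<Longrightarrow> peval e A"
  shows "ded \<Gamma> A"
proof -
  obtain f where f: "\<And>y. y \<in> set ys \<Longrightarrow> set (f y) \<subseteq> \<Gamma> \<and> GR\<^sup>- \<turnstile> imps (f y) y"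
    using assms(1) unfolding ded_def by metis
  let ?xs = "concat (map f ys)"
  have "GR\<^sup>- \<turnstile> imps ?xs A"
  proof (rule GR_taut_consequence[of "map (\<lambda>y. imps (f y) y) ys"])
    show "\<forall>x\<in>set (map (\<lambda>y. imps (f y) y) ys). GR\<^sup>- \<turnstile> x" using f by auto
  next
    fix e assume "\<forall>x\<in>set (map (\<lambda>y. imps (f y) y) ys). peval e x"
    then show "peval e (imps ?xs A)"
      using assms(2)[of e] by (auto simp: peval_imps)
  qed
  then show ?thesis using f unfolding ded_def by (intro exI[of _ ?xs]) auto
qed

lemma ded_theorem: "GR\<^sup>- \<turnstile> A \<Longrightarrow> ded \<Gamma> A"
  unfolding ded_def by (intro exI[of _ "[]"]) simp

lemma ded_member: "A \<in> \<Gamma> \<Longrightarrow> ded \<Gamma> A"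
  unfolding ded_def by (intro exI[of _ "[A]"]) (auto intro!: Taut simp: tautology_def)

lemma ded_deduction:
  assumes "ded (insert A \<Gamma>) B"
  shows "ded \<Gamma> (A \<^bold>\<longrightarrow> B)"
proof -
  obtain xs where xs: "set xs \<subseteq> insert A \<Gamma>" "GR\<^sup>- \<turnstile> imps xs B" using assms unfolding ded_def by auto
  have "GR\<^sup>- \<turnstile> imps (removeAll A xs) (A \<^bold>\<longrightarrow> B)"
    using xs(2) by (intro GR_taut_consequence[of "[imps xs B]"]) (auto simp: peval_imps)
  then show ?thesis using xs(1) unfolding ded_def by (intro exI[of _ "removeAll A xs"]) auto
qed

definition mcs :: "fm set \<Rightarrow> bool"
  where "mcs \<Gamma> \<longleftrightarrow> \<not> ded \<Gamma> \<^bold>\<bottom> \<and> (\<forall>A. A \<in> \<Gamma> \<or> \<^bold>\<not> A \<in> \<Gamma>)"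

lemma mcs_closed:
  assumes "mcs \<Gamma>" "ded \<Gamma> A"
  shows "A \<in> \<Gamma>"
proof (rule ccontr)
  assume "A \<notin> \<Gamma>"
  then have "ded \<Gamma> (\<^bold>\<not> A)" using assms(1) ded_member unfolding mcs_def by blast
  then have "ded \<Gamma> \<^bold>\<bottom>" using assms(2) by (intro ded_taut_consequence[of "[A, \<^bold>\<not> A]"]) auto
  then show False using assms(1) unfolding mcs_def by simp
qed

lemma mcs_taut_consequence:
  assumes "mcs \<Gamma>" "\<forall>x\<in>set ys. x \<in> \<Gamma> \<or> GR\<^sup>- \<turnstile> x" "\<And>e. \<forall>x\<in>set ys. peval e x \<Longrightarrow> peval e A"
  shows "A \<in> \<Gamma>"
proof (rule mcs_closed[OF assms(1)], rule ded_taut_consequence[of ys])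
  show "\<forall>x\<in>set ys. ded \<Gamma> x" using assms(2) ded_member ded_theorem by auto
qed (rule assms(3))

lemma mcs_MP: "mcs \<Gamma> \<Longrightarrow> GR\<^sup>- \<turnstile> A \<^bold>\<longrightarrow> B \<Longrightarrow> A \<in> \<Gamma> \<Longrightarrow> B \<in> \<Gamma>"
  by (rule mcs_taut_consequence[of _ "[A, A \<^bold>\<longrightarrow> B]"]) auto

lemma mcs_Bot: "mcs \<Gamma> \<Longrightarrow> \<^bold>\<bottom> \<notin> \<Gamma>"
  unfolding mcs_def using ded_member by blast

lemma mcs_Neg: "mcs \<Gamma> \<Longrightarrow> \<^bold>\<not> A \<in> \<Gamma> \<longleftrightarrow> A \<notin> \<Gamma>"
proof
  show "A \<notin> \<Gamma>" if "mcs \<Gamma>" "\<^bold>\<not> A \<in> \<Gamma>"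
    using that mcs_taut_consequence[OF that(1), of "[A, \<^bold>\<not> A]" "\<^bold>\<bottom>"] mcs_Bot[OF that(1)] by auto
qed (auto simp only: mcs_def)

lemma mcs_Dis:
  assumes "mcs \<Gamma>"
  shows "A \<^bold>\<or> B \<in> \<Gamma> \<longleftrightarrow> A \<in> \<Gamma> \<or> B \<in> \<Gamma>"
proof -
  have "A \<^bold>\<or> B \<in> \<Gamma>" if "A \<in> \<Gamma>"
    by (rule mcs_taut_consequence[OF assms, of "[A]"]) (use that in auto)
  moreover have "A \<^bold>\<or> B \<in> \<Gamma>" if "B \<in> \<Gamma>"
    by (rule mcs_taut_consequence[OF assms, of "[B]"]) (use that in auto)
  moreover have "B \<in> \<Gamma>" if "A \<^bold>\<or> B \<in> \<Gamma>" "\<^bold>\<not> A \<in> \<Gamma>"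
    by (rule mcs_taut_consequence[OF assms, of "[A \<^bold>\<or> B, \<^bold>\<not> A]"]) (use that in auto)
  ultimately show ?thesis using mcs_Neg[OF assms, of A] by blast
qed

lemma lindenbaum:
  assumes "\<not> ded \<Gamma> \<^bold>\<bottom>"
  obtains \<Delta> where "\<Gamma> \<subseteq> \<Delta>" "mcs \<Delta>"
proof -
  let ?C = "{\<Delta>. \<Gamma> \<subseteq> \<Delta> \<and> \<not> ded \<Delta> \<^bold>\<bottom>}"
  have "\<exists>M\<in>?C. \<forall>X\<in>?C. M \<subseteq> X \<longrightarrow> X = M"
  proof (rule subset_Zorn_nonempty)
    show "?C \<noteq> {}" using assms by auto
    fix c assume c: "c \<noteq> {}" "subset.chain ?C c"
    have "\<not> ded (\<Union>c) \<^bold>\<bottom>"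
    proof
      assume "ded (\<Union>c) \<^bold>\<bottom>"
      then obtain xs where xs: "set xs \<subseteq> \<Union>c" "GR\<^sup>- \<turnstile> imps xs \<^bold>\<bottom>" unfolding ded_def by auto
      obtain Y where "Y \<in> c" "set xs \<subseteq> Y"
        using finite_subset_Union_chain[of "set xs" c ?C] xs(1) c by auto
      then show False using xs(2) c(2) unfolding ded_def subset.chain_def by blast
    qed
    then show "\<Union>c \<in> ?C" using c unfolding subset.chain_def by blast
  qed
  then obtain M where M: "\<Gamma> \<subseteq> M" "\<not> ded M \<^bold>\<bottom>" "\<And>X. \<Gamma> \<subseteq> X \<Longrightarrow> \<not> ded X \<^bold>\<bottom> \<Longrightarrow> M \<subseteq> X \<Longrightarrow> X = M" by auto
  have "mcs M"
    unfolding mcs_def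
  proof (intro conjI allI M(2) disjCI)
    \<comment> \<open>If \<open>Neg A\<close> cannot be added consistently, then \<open>A\<close> is
      derivable, hence can be added, and maximality puts it into \<open>M\<close>.\<close>
    fix A assume "\<^bold>\<not> A \<notin> M"
    then have "ded (insert (\<^bold>\<not> A) M) \<^bold>\<bottom>" using M by blast
    then have "ded M (\<^bold>\<not> A \<^bold>\<longrightarrow> \<^bold>\<bottom>)" by (rule ded_deduction)
    then have 1: "ded M A" by (intro ded_taut_consequence[of "[\<^bold>\<not> A \<^bold>\<longrightarrow> \<^bold>\<bottom>]"]) auto
    have "\<not> ded (insert A M) \<^bold>\<bottom>"
    proof
      assume "ded (insert A M) \<^bold>\<bottom>"
      then have "ded M (A \<^bold>\<longrightarrow> \<^bold>\<bottom>)" by (rule ded_deduction)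
      with 1 have "ded M \<^bold>\<bottom>" by (intro ded_taut_consequence[of "[A, A \<^bold>\<longrightarrow> \<^bold>\<bottom>]"]) auto
      then show False using M(2) by simp
    qed
    then have "insert A M = M" using M by blast
    then show "A \<in> M" by auto
  qed
  then show thesis using that M(1) by blast
qed

lemma mcs_Box_imps:
  "mcs \<Gamma> \<Longrightarrow> \<^bold>\<box> (imps xs A) \<in> \<Gamma> \<Longrightarrow> \<forall>x\<in>set xs. \<^bold>\<box> x \<in> \<Gamma> \<Longrightarrow> \<^bold>\<box> A \<in> \<Gamma>"
proof (induction xs)
  case (Cons x xs)
  have "\<^bold>\<box> (imps xs A) \<in> \<Gamma>"
    by (rule mcs_taut_consequence[OF Cons.prems(1), of
        "[\<^bold>\<box> (imps (x # xs) A), \<^bold>\<box> x, \<^bold>\<box> (imps (x # xs) A) \<^bold>\<longrightarrow> (\<^bold>\<box> x \<^bold>\<longrightarrow> \<^bold>\<box> (imps xs A))]"])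
      (use Cons.prems K in auto)
  then show ?case using Cons by simp
qed simp

lemma mcs_Box_ded:
  assumes "mcs \<Gamma>" "ded {F. \<^bold>\<box> F \<in> \<Gamma>} A"
  shows "\<^bold>\<box> A \<in> \<Gamma>"
proof -
  obtain xs where xs: "\<forall>x\<in>set xs. \<^bold>\<box> x \<in> \<Gamma>" "GR\<^sup>- \<turnstile> imps xs A"
    using assms(2) unfolding ded_def by auto
  have "\<^bold>\<box> (imps xs A) \<in> \<Gamma>" using mcs_closed[OF assms(1) ded_theorem[OF Nec[OF xs(2)]]] .
  then show ?thesis using mcs_Box_imps[OF assms(1)] xs(1) by blast
qed

text \<open>The transitivity axiom is derived through the black box: \<open>Box_Box_BBox\<close>
  first, then \<open>BBox_Box\<close> under a box.\<close>

lemma mcs_Box_Box: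
  assumes "mcs \<Gamma>" "\<^bold>\<box> A \<in> \<Gamma>"
  shows "\<^bold>\<box> \<^bold>\<box> A \<in> \<Gamma>"
proof -
  have "\<^bold>\<box> \<^bold>\<sqdot> A \<in> \<Gamma>" using mcs_MP[OF assms(1) Box_Box_BBox assms(2)] .
  then have "ded {F. \<^bold>\<box> F \<in> \<Gamma>} (\<^bold>\<box> A)"
    by (intro ded_taut_consequence[of "[\<^bold>\<sqdot> A, \<^bold>\<sqdot> A \<^bold>\<longrightarrow> \<^bold>\<box> A]"])
      (auto intro: ded_member ded_theorem BBox_Box)
  then show ?thesis by (rule mcs_Box_ded[OF assms(1)])
qed

text \<open>Loeb's axiom allows \<open>Box C\<close> into the witness: otherwise
  \<open>Box C \<longrightarrow> C\<close> would follow from the boxed formulas. Gaining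
  \<open>Box C\<close> is what makes the witness a successor in the canonical frame.\<close>

lemma mcs_not_Box:
  assumes "mcs \<Gamma>" "\<^bold>\<box> C \<notin> \<Gamma>"
  obtains \<Delta> where "mcs \<Delta>" "\<And>F. \<^bold>\<box> F \<in> \<Gamma> \<Longrightarrow> F \<in> \<Delta>" "\<^bold>\<box> C \<in> \<Delta>" "C \<notin> \<Delta>"
proof -
  let ?G = "{F. \<^bold>\<box> F \<in> \<Gamma>}"
  have "\<not> ded (insert (\<^bold>\<not> C) (insert (\<^bold>\<box> C) ?G)) \<^bold>\<bottom>"
  proof
    assume "ded (insert (\<^bold>\<not> C) (insert (\<^bold>\<box> C) ?G)) \<^bold>\<bottom>"
    then have "ded ?G (\<^bold>\<box> C \<^bold>\<longrightarrow> (\<^bold>\<not> C \<^bold>\<longrightarrow> \<^bold>\<bottom>))" by (intro ded_deduction)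
    then have "ded ?G (\<^bold>\<box> C \<^bold>\<longrightarrow> C)"
      by (intro ded_taut_consequence[of "[\<^bold>\<box> C \<^bold>\<longrightarrow> (\<^bold>\<not> C \<^bold>\<longrightarrow> \<^bold>\<bottom>)]"]) auto
    then have "\<^bold>\<box> C \<in> \<Gamma>" using mcs_Box_ded[OF assms(1)] mcs_MP[OF assms(1) Loeb] by blast
    then show False using assms(2) by simp
  qed
  then obtain \<Delta> where \<Delta>: "insert (\<^bold>\<not> C) (insert (\<^bold>\<box> C) ?G) \<subseteq> \<Delta>" "mcs \<Delta>" by (rule lindenbaum)
  show thesis using that[of \<Delta>] \<Delta> mcs_Neg[OF \<Delta>(2)] by auto
qed

section \<open>Completeness\<close>

text \<open>\<open>Box Bot\<close> detects terminal worlds. \<open>Box A\<close> and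
  \<open>Box (Neg A)\<close> accompany \<open>BBox A\<close> because the constraints on a terminal
  world concern just these boxes at its predecessors.\<close>

primrec closure_of :: "fm \<Rightarrow> fm set"
  where
    "closure_of (Var p) = {Var p, \<^bold>\<bottom>, \<^bold>\<box> \<^bold>\<bottom>}"
  | "closure_of \<^bold>\<bottom> = {\<^bold>\<bottom>, \<^bold>\<box> \<^bold>\<bottom>}"
  | "closure_of (\<^bold>\<not> A) = insert (\<^bold>\<not> A) (closure_of A)"
  | "closure_of (A \<^bold>\<or> B) = insert (A \<^bold>\<or> B) (closure_of A \<union> closure_of B)"
  | "closure_of (\<^bold>\<box> A) = insert (\<^bold>\<box> A) (closure_of A)"
  | "closure_of (\<^bold>\<sqdot> A) = {\<^bold>\<sqdot> A, \<^bold>\<box> A, \<^bold>\<box> \<^bold>\<not> A, \<^bold>\<not> A} \<union> closure_of A"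

definition adequate :: "fm set \<Rightarrow> bool"
  where "adequate X \<longleftrightarrow> finite X \<and> \<^bold>\<box> \<^bold>\<bottom> \<in> X \<and> (\<forall>A. \<^bold>\<not> A \<in> X \<longrightarrow> A \<in> X) \<and>
    (\<forall>A B. A \<^bold>\<or> B \<in> X \<longrightarrow> A \<in> X \<and> B \<in> X) \<and> (\<forall>A. \<^bold>\<box> A \<in> X \<longrightarrow> A \<in> X) \<and>
    (\<forall>A. \<^bold>\<sqdot> A \<in> X \<longrightarrow> \<^bold>\<box> A \<in> X \<and> \<^bold>\<box> \<^bold>\<not> A \<in> X)"

lemma closure_of_self: "A \<in> closure_of A"
  by (cases A) auto

lemma adequate_closure_of: "adequate (closure_of A)"
proof -
  have "finite (closure_of A)" "\<^bold>\<box> \<^bold>\<bottom> \<in> closure_of A" by (induction A) auto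
  moreover have "B \<in> closure_of A" if "\<^bold>\<not> B \<in> closure_of A" for B
    using that by (induction A) (auto simp: closure_of_self)
  moreover have "B \<in> closure_of A \<and> C \<in> closure_of A" if "B \<^bold>\<or> C \<in> closure_of A" for B C
    using that by (induction A) (auto simp: closure_of_self)
  moreover have "B \<in> closure_of A" if "\<^bold>\<box> B \<in> closure_of A" for B
    using that by (induction A) (auto simp: closure_of_self)
  moreover have "\<^bold>\<box> B \<in> closure_of A \<and> \<^bold>\<box> \<^bold>\<not> B \<in> closure_of A" if "\<^bold>\<sqdot> B \<in> closure_of A" for B
    using that by (induction A) auto
  ultimately show ?thesis unfolding adequate_def by blast
qed

lemma vars_closure_of: "F \<in> closure_of A \<Longrightarrow> vars F \<subseteq> vars A"
  by (induction A) auto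

lemma adequate_BBox: "adequate X \<Longrightarrow> \<^bold>\<sqdot> D \<in> X \<Longrightarrow> \<^bold>\<box> D \<in> X \<and> \<^bold>\<box> \<^bold>\<not> D \<in> X"
  and adequate_Box: "adequate X \<Longrightarrow> \<^bold>\<box> D \<in> X \<Longrightarrow> D \<in> X"
  and adequate_Neg: "adequate X \<Longrightarrow> \<^bold>\<not> D \<in> X \<Longrightarrow> D \<in> X"
  and adequate_Dis: "adequate X \<Longrightarrow> D \<^bold>\<or> E \<in> X \<Longrightarrow> D \<in> X \<and> E \<in> X"
  and adequate_finite: "adequate X \<Longrightarrow> finite X"
  and adequate_Box_Bot: "adequate X \<Longrightarrow> \<^bold>\<box> \<^bold>\<bottom> \<in> X"
  unfolding adequate_def by blast+

text \<open>Demanding a new box from \<open>X\<close> makes the relation conversely well-founded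
  when \<open>X\<close> is finite. The guards \<open>mcs\<close> isolate all other formula sets, so
  the whole type can serve as the set of worlds.\<close>

definition canon :: "fm set \<Rightarrow> fm set \<Rightarrow> fm set \<Rightarrow> bool"
  where "canon X \<Gamma> \<Delta> \<longleftrightarrow> mcs \<Gamma> \<and> mcs \<Delta> \<and> (\<forall>F. \<^bold>\<box> F \<in> \<Gamma> \<longrightarrow> F \<in> \<Delta>) \<and>
    (\<exists>E. \<^bold>\<box> E \<in> X \<and> \<^bold>\<box> E \<in> \<Delta> \<and> \<^bold>\<box> E \<notin> \<Gamma>)"

abbreviation (input) "canon_val \<equiv> (\<lambda>\<Gamma> F. F \<in> \<Gamma>)"
abbreviation "bboxed X \<equiv> {D. \<^bold>\<sqdot> D \<in> X}"

lemma canon_mcs: "canon X \<Gamma> \<Delta> \<Longrightarrow> mcs \<Delta>"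
  unfolding canon_def by simp

lemma canon_successor:
  assumes "\<^bold>\<box> C \<in> X" "mcs \<Gamma>" "\<^bold>\<box> C \<notin> \<Gamma>"
  shows "\<exists>\<Delta>. canon X \<Gamma> \<Delta> \<and> C \<notin> \<Delta>"
  using mcs_not_Box[OF assms(2,3)] assms unfolding canon_def by metis

lemma canon_terminal:
  assumes "adequate X" "mcs \<Gamma>"
  shows "(\<exists>\<Delta>. canon X \<Gamma> \<Delta>) \<longleftrightarrow> \<^bold>\<box> \<^bold>\<bottom> \<notin> \<Gamma>"
  using canon_successor[of "\<^bold>\<bottom>" X \<Gamma>] assms(2) adequate_Box_Bot[OF assms(1)] mcs_Bot unfolding canon_def by blast

lemma canon_truth:
  assumes "adequate X" "mcs \<Gamma>" "F \<in> X"
  shows "sat (canon X) canon_val (bboxed X) \<Gamma> F \<longleftrightarrow> F \<in> \<Gamma>"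
  using assms(2,3)
proof (induction F arbitrary: \<Gamma>)
  case Bot
  then show ?case using mcs_Bot by simp
next
  case (Neg F)
  then show ?case using adequate_Neg[OF assms(1)] mcs_Neg by simp
next
  case (Dis F G)
  then have "F \<in> X" "G \<in> X" using adequate_Dis[OF assms(1)] by blast+
  then show ?case using Dis mcs_Dis by simp
next
  case (Box F)
  then have "F \<in> X" using adequate_Box[OF assms(1)] by blast
  then have "sat (canon X) canon_val (bboxed X) \<Gamma> (\<^bold>\<box> F) \<longleftrightarrow> (\<forall>\<Delta>. canon X \<Gamma> \<Delta> \<longrightarrow> F \<in> \<Delta>)"
    using Box.IH canon_mcs by auto
  also have "\<dots> \<longleftrightarrow> \<^bold>\<box> F \<in> \<Gamma>"
    using canon_successor[OF Box.prems(2,1)] unfolding canon_def by blast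
  finally show ?case .
next
  case (BBox F)
  then have X: "\<^bold>\<box> F \<in> X" "F \<in> X" using adequate_Box[OF assms(1)] adequate_BBox[OF assms(1)] by blast+
  show ?case
  proof (cases "\<exists>\<Delta>. canon X \<Gamma> \<Delta>")
    case True
    then have "\<^bold>\<box> \<^bold>\<bottom> \<notin> \<Gamma>" using canon_terminal[OF assms(1) BBox.prems(1)] by blast
    \<comment> \<open>At a nonterminal world the two boxes agree: \<open>Box F\<close> yields
      \<open>Box Bot\<close> or \<open>BBox F\<close>, and the former is excluded.\<close>
    then have "\<^bold>\<sqdot> F \<in> \<Gamma> \<longleftrightarrow> \<^bold>\<box> F \<in> \<Gamma>"
      using mcs_MP[OF BBox.prems(1) BBox_Box] mcs_MP[OF BBox.prems(1) Box_BBox]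
        mcs_Dis[OF BBox.prems(1)] by blast
    also have "\<dots> \<longleftrightarrow> (\<forall>\<Delta>. canon X \<Gamma> \<Delta> \<longrightarrow> F \<in> \<Delta>)"
      using canon_successor[OF X(1) BBox.prems(1)] unfolding canon_def by blast
    also have "\<dots> \<longleftrightarrow> sat (canon X) canon_val (bboxed X) \<Gamma> (\<^bold>\<sqdot> F)"
      using BBox.IH[OF canon_mcs X(2)] True by simp
    finally show ?thesis by simp
  next
    case False
    then show ?thesis using BBox.prems by simp
  qed
qed simp

lemma canon_rosser_model:
  assumes "adequate X"
  shows "rosser_model (canon X) canon_val (bboxed X)"
  unfolding rosser_model_def
proof (intro conjI allI impI)
  show "transp (canon X)"
  proof (rule transpI)
    fix \<Gamma> \<Delta> \<Theta> assume *: "canon X \<Gamma> \<Delta>" "canon X \<Delta> \<Theta>"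
    then have "\<^bold>\<box> F \<in> \<Theta>" if "\<^bold>\<box> F \<in> \<Delta>" for F
      using mcs_Box_Box that unfolding canon_def by blast
    moreover have "F \<in> \<Theta>" if "\<^bold>\<box> F \<in> \<Gamma>" for F
      using mcs_Box_Box that * unfolding canon_def by blast
    ultimately show "canon X \<Gamma> \<Theta>" using * unfolding canon_def by blast
  qed
  let ?d = "\<lambda>\<Gamma>. card {F \<in> X. F \<notin> \<Gamma> \<and> (\<exists>E. F = \<^bold>\<box> E)}"
  have "?d \<Delta> < ?d \<Gamma>" if "canon X \<Gamma> \<Delta>" for \<Gamma> \<Delta>
  proof (rule psubset_card_mono)
    show "finite {F \<in> X. F \<notin> \<Gamma> \<and> (\<exists>E. F = \<^bold>\<box> E)}" using adequate_finite[OF assms] by simp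
    have "\<And>F. \<^bold>\<box> F \<in> \<Gamma> \<Longrightarrow> \<^bold>\<box> F \<in> \<Delta>" using that mcs_Box_Box unfolding canon_def by blast
    then show "{F \<in> X. F \<notin> \<Delta> \<and> (\<exists>E. F = \<^bold>\<box> E)} \<subset> {F \<in> X. F \<notin> \<Gamma> \<and> (\<exists>E. F = \<^bold>\<box> E)}"
      using that unfolding canon_def by blast
  qed
  then show "wfp (canon X)\<inverse>\<inverse>" by (intro wfp_if_convertible_to_nat[of _ ?d]) simp
next
  fix \<Gamma> \<Delta> D assume *: "canon X \<Gamma> \<Delta>" "D \<in> bboxed X"
  then have X: "\<^bold>\<box> D \<in> X" "\<^bold>\<box> \<^bold>\<not> D \<in> X" and mcs: "mcs \<Gamma>" "mcs \<Delta>"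
    using adequate_BBox[OF assms] unfolding canon_def by auto
  show "\<^bold>\<sqdot> D \<in> \<Delta>" if "\<forall>v. canon X \<Gamma> v \<longrightarrow> sat (canon X) canon_val (bboxed X) v D"
  proof -
    have "\<^bold>\<box> D \<in> \<Gamma>" using that canon_truth[OF assms mcs(1) X(1)] by simp
    then have "\<^bold>\<box> \<^bold>\<sqdot> D \<in> \<Gamma>" by (rule mcs_MP[OF mcs(1) Box_Box_BBox])
    then show ?thesis using * unfolding canon_def by blast
  qed
  show "\<^bold>\<sqdot> D \<notin> \<Delta>" if "\<forall>v. canon X \<Gamma> v \<longrightarrow> \<not> sat (canon X) canon_val (bboxed X) v D"
  proof -
    have "\<^bold>\<box> \<^bold>\<not> D \<in> \<Gamma>" using that canon_truth[OF assms mcs(1) X(2)] by simp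
    \<comment> \<open>This is \<open>Dia_BBox\<close> read contrapositively.\<close>
    then have "\<^bold>\<box> \<^bold>\<not> \<^bold>\<sqdot> D \<in> \<Gamma>"
      by (intro mcs_taut_consequence[OF mcs(1), of "[\<^bold>\<box> \<^bold>\<not> D, \<^bold>\<diamond> (\<^bold>\<sqdot> D) \<^bold>\<longrightarrow> \<^bold>\<diamond> D]"])
        (auto intro: Dia_BBox)
    then show ?thesis using * mcs_Neg[OF mcs(2)] unfolding canon_def by blast
  qed
qed

text \<open>Countermodels live on the fixed type of formula sets, so that the interpolant can be
  built from models of a single type.\<close>

theorem completeness:
  assumes "\<not> GR\<^sup>- \<turnstile> A"
  obtains R e S and w :: "fm set" where "rosser_model R e S" "\<not> sat R e S w A"
proof -
  have "\<not> ded {\<^bold>\<not> A} \<^bold>\<bottom>"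
  proof
    assume "ded {\<^bold>\<not> A} \<^bold>\<bottom>"
    then have "ded {} (\<^bold>\<not> A \<^bold>\<longrightarrow> \<^bold>\<bottom>)" by (rule ded_deduction)
    then have "ded {} A" by (intro ded_taut_consequence[of "[\<^bold>\<not> A \<^bold>\<longrightarrow> \<^bold>\<bottom>]"]) auto
    then show False using assms unfolding ded_def by auto
  qed
  then obtain \<Gamma> where \<Gamma>: "{\<^bold>\<not> A} \<subseteq> \<Gamma>" "mcs \<Gamma>" by (rule lindenbaum)
  then have "A \<notin> \<Gamma>" using mcs_Neg by blast
  then show thesis
    using that[OF canon_rosser_model[OF adequate_closure_of[of A]], of \<Gamma>]
      canon_truth[OF adequate_closure_of \<Gamma>(2) closure_of_self[of A]] by simp
qed

section \<open>Layered bisimulation and characteristic formulas\<close>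

text \<open>\<open>T\<close> and \<open>T'\<close> are truth predicates on formulas rather than
  valuations of variables, because \<open>Q\<close> will also contain black boxed formulas as
  atoms.\<close>

primrec bisim :: "fm set \<Rightarrow> ('w \<Rightarrow> 'w \<Rightarrow> bool) \<Rightarrow> ('w \<Rightarrow> fm \<Rightarrow> bool) \<Rightarrow>
    ('v \<Rightarrow> 'v \<Rightarrow> bool) \<Rightarrow> ('v \<Rightarrow> fm \<Rightarrow> bool) \<Rightarrow> nat \<Rightarrow> 'w \<Rightarrow> 'v \<Rightarrow> bool"
  where
    "bisim Q R T R' T' 0 w v = (\<forall>F\<in>Q. T w F = T' v F)"
  | "bisim Q R T R' T' (Suc n) w v = ((\<forall>F\<in>Q. T w F = T' v F) \<and>
      (\<forall>w'. R w w' \<longrightarrow> (\<exists>v'. R' v v' \<and> bisim Q R T R' T' n w' v')) \<and>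
      (\<forall>v'. R' v v' \<longrightarrow> (\<exists>w'. R w w' \<and> bisim Q R T R' T' n w' v')))"

lemma bisim_atoms: "bisim Q R T R' T' n w v \<Longrightarrow> F \<in> Q \<Longrightarrow> T w F = T' v F"
  by (cases n) auto

lemma bisim_Suc_lower: "bisim Q R T R' T' (Suc n) w v \<Longrightarrow> bisim Q R T R' T' n w v"
proof (induction n arbitrary: w v)
  case (Suc n)
  have "(\<forall>F\<in>Q. T w F = T' v F)" using Suc.prems by simp
  moreover have "\<exists>v'. R' v v' \<and> bisim Q R T R' T' n w' v'" if "R w w'" for w'
    using Suc that by (meson bisim.simps(2))
  moreover have "\<exists>w'. R w w' \<and> bisim Q R T R' T' n w' v'" if "R' v v'" for v'
    using Suc that by (meson bisim.simps(2))
  ultimately show ?case by simp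
qed simp

lemma bisim_lower: "bisim Q R T R' T' n w v \<Longrightarrow> m \<le> n \<Longrightarrow> bisim Q R T R' T' m w v"
  by (induction n rule: nat_induct) (auto simp: le_Suc_eq simp del: bisim.simps dest: bisim_Suc_lower)

section \<open>Finite disjunctions and conjunctions as formulas\<close>

definition Disj :: "fm set \<Rightarrow> fm"
  where "Disj X = foldr (\<^bold>\<or>) (SOME xs. set xs = X) \<^bold>\<bottom>"

definition Conj :: "fm set \<Rightarrow> fm"
  where "Conj X = \<^bold>\<not> Disj (Neg ` X)"

lemma Disj_list:
  assumes "finite X"
  obtains xs where "set xs = X" "Disj X = foldr (\<^bold>\<or>) xs \<^bold>\<bottom>"
  using someI_ex[OF finite_list[OF assms]] unfolding Disj_def by blast

lemma sat_Disj:
  assumes "finite X"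
  shows "sat R e S w (Disj X) \<longleftrightarrow> (\<exists>F\<in>X. sat R e S w F)"
proof -
  obtain xs where xs: "set xs = X" "Disj X = foldr (\<^bold>\<or>) xs \<^bold>\<bottom>" by (rule Disj_list[OF assms])
  have "sat R e S w (foldr (\<^bold>\<or>) xs \<^bold>\<bottom>) \<longleftrightarrow> (\<exists>F\<in>set xs. sat R e S w F)" by (induction xs) auto
  then show ?thesis using xs by simp
qed

lemma vars_Disj:
  assumes "finite X"
  shows "vars (Disj X) = \<Union> (vars ` X)"
proof -
  obtain xs where xs: "set xs = X" "Disj X = foldr (\<^bold>\<or>) xs \<^bold>\<bottom>" by (rule Disj_list[OF assms])
  have "vars (foldr (\<^bold>\<or>) xs \<^bold>\<bottom>) = \<Union> (vars ` set xs)" by (induction xs) auto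
  then show ?thesis using xs by simp
qed

lemma sat_Conj: "finite X \<Longrightarrow> sat R e S w (Conj X) \<longleftrightarrow> (\<forall>F\<in>X. sat R e S w F)"
  unfolding Conj_def by (simp add: sat_Disj)

lemma vars_Conj: "finite X \<Longrightarrow> vars (Conj X) = \<Union> (vars ` X)"
  unfolding Conj_def by (simp add: vars_Disj)

definition literals :: "fm set \<Rightarrow> fm set \<Rightarrow> fm"
  where "literals Q U = Conj ((\<lambda>F. if F \<in> U then F else \<^bold>\<not> F) ` Q)"

text \<open>This is the cover (nabla) modality of \<open>X\<close>, conjoined with the local
  information \<open>L\<close>.\<close>

definition layer :: "fm \<Rightarrow> fm set \<Rightarrow> fm"
  where "layer L X = Conj {L, Conj (Dia ` X), \<^bold>\<box> Disj X}"

primrec characteristic :: "fm set \<Rightarrow> ('w \<Rightarrow> 'w \<Rightarrow> bool) \<Rightarrow> ('w \<Rightarrow> fm \<Rightarrow> bool) \<Rightarrow> nat \<Rightarrow> 'w \<Rightarrow> fm"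
  where
    "characteristic Q R T 0 w = literals Q {F \<in> Q. T w F}"
  | "characteristic Q R T (Suc n) w =
      layer (literals Q {F \<in> Q. T w F}) (characteristic Q R T n ` {v. R w v})"

text \<open>An overapproximation that mentions no model. Its finiteness allows a disjunction over
  all models.\<close>

primrec characteristics :: "fm set \<Rightarrow> nat \<Rightarrow> fm set"
  where
    "characteristics Q 0 = literals Q ` Pow Q"
  | "characteristics Q (Suc n) = (\<Union>L \<in> literals Q ` Pow Q. layer L ` Pow (characteristics Q n))"

lemma finite_characteristics: "finite Q \<Longrightarrow> finite (characteristics Q n)"
  by (induction n) auto

lemma characteristic_in: "characteristic Q R T n w \<in> characteristics Q n"
proof (induction n arbitrary: w)
  case (Suc n)
  then show ?case by (auto intro!: imageI)
qed auto

lemma finite_characteristic_image: "finite Q \<Longrightarrow> finite (characteristic Q R T n ` W)"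
  by (rule finite_subset[OF _ finite_characteristics]) (use characteristic_in in auto)

lemma vars_literals: "finite Q \<Longrightarrow> vars (literals Q U) = \<Union> (vars ` Q)"
  unfolding literals_def by (auto simp: vars_Conj)

lemma vars_characteristics:
  assumes "finite Q"
  shows "C \<in> characteristics Q n \<Longrightarrow> vars C \<subseteq> \<Union> (vars ` Q)"
proof (induction n arbitrary: C)
  case 0
  then show ?case using vars_literals[OF assms] by auto
next
  case (Suc n)
  then obtain U X where C: "C = layer (literals Q U) X" and X: "X \<subseteq> characteristics Q n" by auto
  have "finite X" using X finite_characteristics[OF assms] finite_subset by blast
  then have "vars C = \<Union> (vars ` Q) \<union> \<Union> (vars ` X)"
    unfolding C layer_def by (simp add: vars_Conj vars_Disj vars_literals[OF assms])
  then show ?case using X Suc.IH by blast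
qed

lemma sat_literals:
  assumes "finite Q"
  shows "sat R e S w (literals Q U) \<longleftrightarrow> (\<forall>F\<in>Q. sat R e S w F \<longleftrightarrow> F \<in> U)"
proof -
  have "sat R e S w (literals Q U) \<longleftrightarrow> (\<forall>F\<in>Q. sat R e S w (if F \<in> U then F else \<^bold>\<not> F))"
    unfolding literals_def using assms by (simp add: sat_Conj del: if_image_distrib)
  then show ?thesis by auto
qed

lemma sat_layer:
  assumes "finite X"
  shows "sat R e S w (layer L X) \<longleftrightarrow> sat R e S w L \<and>
    (\<forall>F\<in>X. \<exists>v. R w v \<and> sat R e S v F) \<and> (\<forall>v. R w v \<longrightarrow> (\<exists>F\<in>X. sat R e S v F))"
  unfolding layer_def using assms by (simp add: sat_Conj sat_Disj)

lemma sat_own_characteristic: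
  assumes "finite Q"
  shows "sat R e S w (characteristic Q R (sat R e S) n w)"
proof (induction n arbitrary: w)
  case 0
  then show ?case by (auto simp: sat_literals assms)
next
  case (Suc n)
  then show ?case by (auto simp: sat_layer sat_literals finite_characteristic_image assms)
qed

text \<open>The diamonds of a layer give the forth condition, its boxed disjunction the back
  condition.\<close>

lemma bisim_if_sat_characteristic:
  assumes "finite Q"
  shows "sat R' e' S' v (characteristic Q R T n w) \<Longrightarrow> bisim Q R T R' (sat R' e' S') n w v"
proof (induction n arbitrary: w v)
  case 0
  then show ?case by (auto simp: sat_literals assms)
next
  case (Suc n)
  then have "\<forall>F\<in>Q. T w F = sat R' e' S' v F"
    and *: "\<And>w'. R w w' \<Longrightarrow> \<exists>v'. R' v v' \<and> sat R' e' S' v' (characteristic Q R T n w')"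
      "\<And>v'. R' v v' \<Longrightarrow> \<exists>w'. R w w' \<and> sat R' e' S' v' (characteristic Q R T n w')"
    by (auto simp: sat_layer sat_literals finite_characteristic_image assms)
  moreover have "\<And>w'. R w w' \<Longrightarrow> \<exists>v'. R' v v' \<and> bisim Q R T R' (sat R' e' S') n w' v'"
    "\<And>v'. R' v v' \<Longrightarrow> \<exists>w'. R w w' \<and> bisim Q R T R' (sat R' e' S') n w' v'"
    using * Suc.IH by blast+
  ultimately show ?case by simp
qed

section \<open>Amalgamation\<close>

text \<open>Black boxed formulas count as atoms because at terminal worlds the variables do not
  determine their values.\<close>

definition shared_atoms :: "fm \<Rightarrow> nat set \<Rightarrow> fm set"
  where "shared_atoms A P = Var ` (vars A - P) \<union> {\<^bold>\<sqdot> D |D. \<^bold>\<sqdot> D \<in> closure_of A \<and> vars D \<inter> P = {}}"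

lemma finite_vars: "finite (vars A)"
  by (induction A) auto

lemma finite_shared_atoms: "finite (shared_atoms A P)"
proof -
  have "{\<^bold>\<sqdot> D |D. \<^bold>\<sqdot> D \<in> closure_of A \<and> vars D \<inter> P = {}} \<subseteq> closure_of A" by auto
  then show ?thesis
    unfolding shared_atoms_def
    using finite_vars finite_subset[OF _ adequate_finite[OF adequate_closure_of[of A]]] by simp
qed

lemma vars_shared_atoms: "F \<in> shared_atoms A P \<Longrightarrow> vars F \<subseteq> vars A - P"
  using vars_closure_of unfolding shared_atoms_def by fastforce

text \<open>The first model will govern the formulas in the closure of \<open>A\<close>, the second
  one those free of \<open>P\<close>.\<close>

locale amalgamation =
  fixes RM :: "'m \<Rightarrow> 'm \<Rightarrow> bool" and eM SM and RN :: "'n \<Rightarrow> 'n \<Rightarrow> bool" and eN SN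
    and A :: fm and P :: "nat set"
  assumes model_M: "rosser_model RM eM SM" and model_N: "rosser_model RN eN SN"
begin

abbreviation "satM \<equiv> sat RM eM SM"
abbreviation "satN \<equiv> sat RN eN SN"
abbreviation "bis \<equiv> bisim (shared_atoms A P) RM satM RN satN"

definition boxes :: "'m \<Rightarrow> fm set"
  where "boxes k = {F \<in> closure_of A. (\<exists>E. F = \<^bold>\<box> E) \<and> satM k F}"

text \<open>Each drop of the rank frees two layers of bisimilarity: one for the step taken, one for
  the surplus layer demanded of a new base.\<close>

definition rank :: "'m \<Rightarrow> nat"
  where "rank k = card ({F \<in> closure_of A. \<exists>E. F = \<^bold>\<box> E} - boxes k)"

text \<open>A pair is linked through a base pair below it: steps in the second model that do not lower
  the rank are answered from the base, so they do not use up layers of the bisimulation.\<close>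

definition linked :: "'m \<Rightarrow> 'n \<Rightarrow> bool"
  where "linked k m \<longleftrightarrow> (\<exists>k' m'. (k' = k \<or> RM k' k) \<and> (m' = m \<or> RN m' m) \<and> boxes k' = boxes k \<and>
    bis (2 * rank k + 1) k' m' \<and> bis (2 * rank k) k m)"

text \<open>\<open>RM k l\<close> would be too strong, since \<open>l\<close> may be chosen above
  the base of the pair and not above \<open>k\<close>. Inclusion of boxes still passes the boxes of
  \<open>k\<close> on to \<open>l\<close> and keeps the relation transitive.\<close>

fun RK :: "'m \<times> 'n \<Rightarrow> 'm \<times> 'n \<Rightarrow> bool"
  where "RK (k, m) (l, n) \<longleftrightarrow> linked k m \<and> linked l n \<and> RN m n \<and> (\<exists>k'. boxes k \<subseteq> boxes k' \<and> RM k' l)"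

text \<open>For atoms of the closure free of \<open>P\<close> either source gives the same value at
  a linked pair. Evaluated truth is copied, not \<open>eM\<close> or \<open>eN\<close>, so defaults
  of the given models are respected.\<close>

definition eK :: "'m \<times> 'n \<Rightarrow> fm \<Rightarrow> bool"
  where "eK = (\<lambda>(k, m) F. if F \<in> closure_of A then satM k F else satN m F)"

text \<open>For any other \<open>D\<close> no value of the black box is taken from either model; the
  default of \<open>sat\<close> meets the constraints by itself.\<close>

definition SK :: "fm set"
  where "SK = {D. \<^bold>\<sqdot> D \<in> closure_of A \<or> vars D \<inter> P = {}}"

abbreviation "satK \<equiv> sat RK eK SK"

section \<open>Rank and moves between linked pairs\<close>

lemma finite_boxes: "finite {F \<in> closure_of A. \<exists>E. F = \<^bold>\<box> E}"
  using adequate_finite[OF adequate_closure_of] by simp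

lemma boxes_subset: "boxes k \<subseteq> {F \<in> closure_of A. \<exists>E. F = \<^bold>\<box> E}"
  unfolding boxes_def by auto

lemma rank_less: "boxes k \<subset> boxes l \<Longrightarrow> rank l < rank k"
  unfolding rank_def using boxes_subset[of l]
  by (intro psubset_card_mono) (use finite_boxes in auto)

lemma rank_cong: "boxes k = boxes l \<Longrightarrow> rank k = rank l"
  unfolding rank_def by simp

lemma boxes_mono: "RM k l \<Longrightarrow> boxes k \<subseteq> boxes l"
  unfolding boxes_def using rosser_model_transD[OF model_M] by auto

lemma linked_if_bis: "bis (2 * rank k + 1) k m \<Longrightarrow> linked k m"
  unfolding linked_def using bisim_lower[of _ _ _ _ _ "2 * rank k + 1" k m "2 * rank k"]
  by (intro exI[of _ k] exI[of _ m]) (simp del: bisim.simps)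

lemma linked_bis: "linked k m \<Longrightarrow> bis (2 * rank k) k m"
  unfolding linked_def by blast

text \<open>The answer is sought above the base, where one extra layer is available, instead of
  above \<open>k\<close>.\<close>

lemma linked_back:
  assumes "linked k m" "RN m n"
  obtains l k' where "boxes k' = boxes k" "RM k' l" "RK (k, m) (l, n)"
proof -
  obtain k' m' where k: "k' = k \<or> RM k' k" "m' = m \<or> RN m' m" "boxes k' = boxes k"
    "bis (2 * rank k + 1) k' m'" using assms(1) unfolding linked_def by blast
  have "RN m' n" using k(2) assms(2) rosser_model_transD[OF model_N] by blast
  then obtain l where l: "RM k' l" "bis (2 * rank k) l n" using k(4) by auto
  have "linked l n"
  proof (cases "boxes l = boxes k")
    case True
    then have "rank l = rank k" by (rule rank_cong)
    \<comment> \<open>The rank is unchanged, so the old base also serves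
      \<open>(l, n)\<close>.\<close>
    then show ?thesis unfolding linked_def using k l True \<open>RN m' n\<close> by auto
  next
    case False
    then have "rank l < rank k" using boxes_mono[OF l(1)] k(3) by (intro rank_less) auto
    \<comment> \<open>The rank has dropped, so the remaining layers let \<open>(l, n)\<close> be its
      own base.\<close>
    then show ?thesis using l(2) by (intro linked_if_bis) (auto elim: bisim_lower simp del: bisim.simps)
  qed
  then show thesis using that[of k' l] k(3) l(1) assms by auto
qed

text \<open>At a last counterexample to \<open>C\<close> the formula \<open>Box C\<close> is newly
  true, so the rank drops and the layers of the pair itself suffice.\<close>

lemma linked_forth:
  assumes "linked k m" "\<^bold>\<box> C \<in> closure_of A" "\<not> satM k (\<^bold>\<box> C)"
  obtains l n where "RK (k, m) (l, n)" "\<not> satM l C"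
proof -
  obtain l where l: "RM k l" "\<not> satM l C" "satM l (\<^bold>\<box> C)"
    using sat_Box_last_counterexample[OF model_M assms(3)] .
  have "\<^bold>\<box> C \<in> boxes l" "\<^bold>\<box> C \<notin> boxes k" using assms(2,3) l(3) by (auto simp: boxes_def)
  then have less: "rank l < rank k" using boxes_mono[OF l(1)] by (intro rank_less) auto
  \<comment> \<open>The step uses one layer; since the rank drops, at least
    \<open>2 * rank l + 1\<close> layers remain.\<close>
  then obtain d where d: "2 * rank k = Suc d" "2 * rank l + 1 \<le> d" by (cases "2 * rank k") auto
  obtain n where n: "RN m n" "bis d l n" using linked_bis[OF assms(1)] l(1) unfolding d(1) by auto
  have "linked l n" using bisim_lower[OF n(2) d(2)] by (rule linked_if_bis)
  then show thesis using that[of l n] l n assms by auto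
qed

text \<open>Agreement on terminality makes \<open>sat\<close> treat black boxes alike in all three
  models. \<open>linked_forth\<close> answers only failing boxes of the closure, hence its use with
  \<open>Box Bot\<close>; conversely \<open>Box Bot\<close> fails at the base and so at
  \<open>k\<close>, which has the same boxes.\<close>

lemma linked_terminal:
  assumes "linked k m"
  shows "(\<exists>l. RM k l) \<longleftrightarrow> (\<exists>n. RN m n)" "(\<exists>x. RK (k, m) x) \<longleftrightarrow> (\<exists>n. RN m n)"
proof -
  note bot = adequate_Box_Bot[OF adequate_closure_of[of A]]
  show "(\<exists>l. RM k l) \<longleftrightarrow> (\<exists>n. RN m n)"
  proof
    assume "\<exists>l. RM k l"
    then have "\<not> satM k (\<^bold>\<box> \<^bold>\<bottom>)" by simp
    then obtain l n where "RK (k, m) (l, n)" using linked_forth[OF assms bot] by metis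
    then show "\<exists>n. RN m n" by auto
  next
    assume "\<exists>n. RN m n"
    then obtain n where "RN m n" by blast
    then obtain l k' where k': "boxes k' = boxes k" "RM k' l" using linked_back[OF assms] by metis
    have "\<^bold>\<box> \<^bold>\<bottom> \<notin> boxes k" using k'(2) unfolding k'(1)[symmetric] unfolding boxes_def by auto
    then show "\<exists>l. RM k l" using bot unfolding boxes_def by simp
  qed
  show "(\<exists>x. RK (k, m) x) \<longleftrightarrow> (\<exists>n. RN m n)"
    using linked_back[OF assms] by fastforce
qed

text \<open>A failing box is refuted through \<open>linked_forth\<close>; a true one also holds at
  the world \<open>k'\<close> in the definition of \<open>RK\<close>, hence its argument holds at
  \<open>l\<close>.\<close>

lemma linked_Box_iff:
  assumes "linked k m" "\<^bold>\<box> C \<in> closure_of A" "\<And>l n. linked l n \<Longrightarrow> satK (l, n) C = satM l C"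
  shows "satK (k, m) (\<^bold>\<box> C) = satM k (\<^bold>\<box> C)"
proof
  assume *: "satK (k, m) (\<^bold>\<box> C)"
  show "satM k (\<^bold>\<box> C)"
  proof (rule ccontr)
    assume "\<not> satM k (\<^bold>\<box> C)"
    then obtain l n where "RK (k, m) (l, n)" "\<not> satM l C" using linked_forth[OF assms(1,2)] by metis
    moreover from this have "linked l n" by simp
    ultimately show False using assms(3) * by fastforce
  qed
next
  assume "satM k (\<^bold>\<box> C)"
  then have k: "\<^bold>\<box> C \<in> boxes k" using assms(2) by (simp add: boxes_def)
  have "satK (l, n) C" if "RK (k, m) (l, n)" for l n
  proof -
    obtain k' where "boxes k \<subseteq> boxes k'" "RM k' l" "linked l n" using \<open>RK (k, m) (l, n)\<close> by auto
    moreover from this have "satM k' (\<^bold>\<box> C)" using k by (auto simp: boxes_def)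
    ultimately show ?thesis using assms(3) by simp
  qed
  then show "satK (k, m) (\<^bold>\<box> C)" by auto
qed

lemma satK_eq_satM:
  assumes "F \<in> closure_of A" "linked k m"
  shows "satK (k, m) F = satM k F"
  using assms
proof (induction F arbitrary: k m)
  case (Var p)
  then show ?case by (simp add: eK_def)
next
  case (Neg F)
  then show ?case using adequate_Neg[OF adequate_closure_of] by simp
next
  case (Dis F G)
  then have "F \<in> closure_of A" "G \<in> closure_of A" using adequate_Dis[OF adequate_closure_of] by blast+
  then show ?case using Dis by simp
next
  case (Box F)
  then show ?case using linked_Box_iff adequate_Box[OF adequate_closure_of] by blast
next
  case (BBox F)
  then have F: "\<^bold>\<box> F \<in> closure_of A" "F \<in> closure_of A"
    using adequate_BBox[OF adequate_closure_of] adequate_Box[OF adequate_closure_of] by blast+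
  show ?case
  proof (cases "\<exists>n. RN m n")
    case True
    then obtain l x where "RM k l" "RK (k, m) x" using linked_terminal[OF BBox.prems(2)] by blast
    then show ?thesis
      using linked_Box_iff[OF BBox.prems(2) F(1) BBox.IH[OF F(2)]] sat_BBox_nonterminal by metis
  next
    case False
    then have "\<nexists>x. RK (k, m) x" using linked_terminal[OF BBox.prems(2)] by blast
    then show ?thesis using BBox.prems by (simp add: eK_def SK_def del: RK.simps)
  qed
qed simp

lemma satK_eq_satN:
  assumes "vars F \<inter> P = {}" "linked k m"
  shows "satK (k, m) F = satN m F"
  using assms
proof (induction F arbitrary: k m)
  case (Var p)
  have "satM k (Var p) = satN m (Var p)" if "Var p \<in> closure_of A"
  proof -
    have "Var p \<in> shared_atoms A P"
      using vars_closure_of[OF that] Var.prems(1) unfolding shared_atoms_def by auto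
    then show ?thesis using bisim_atoms[OF linked_bis[OF Var.prems(2)]] by blast
  qed
  then show ?case by (simp add: eK_def)
next
  case (Dis F G)
  then have "vars F \<inter> P = {}" "vars G \<inter> P = {}" by auto
  then show ?case using Dis by simp
next
  case (Box F)
  then have IH: "\<And>l n. linked l n \<Longrightarrow> satK (l, n) F = satN n F" by simp
  \<comment> \<open>The second components of the \<open>RK\<close>-successors are exactly the
    \<open>RN\<close>-successors of \<open>m\<close>.\<close>
  have "(\<forall>l n. RK (k, m) (l, n) \<longrightarrow> satN n F) \<longleftrightarrow> (\<forall>n. RN m n \<longrightarrow> satN n F)"
    using linked_back[OF Box.prems(2)] by (metis RK.simps)
  then show ?case using IH by auto
next
  case (BBox F)
  then have IH: "\<And>l n. linked l n \<Longrightarrow> satK (l, n) F = satN n F" by simp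
  show ?case
  proof (cases "\<exists>n. RN m n")
    case True
    then obtain n x where nx: "RN m n" "RK (k, m) x" using linked_terminal[OF BBox.prems(2)] by blast
    have "(\<forall>l n. RK (k, m) (l, n) \<longrightarrow> satN n F) \<longleftrightarrow> (\<forall>n. RN m n \<longrightarrow> satN n F)"
      using linked_back[OF BBox.prems(2)] by (metis RK.simps)
    then have "satK (k, m) (\<^bold>\<box> F) = satN m (\<^bold>\<box> F)" using IH by auto
    then show ?thesis using nx sat_BBox_nonterminal by metis
  next
    case False
    then have "\<nexists>x. RK (k, m) x" using linked_terminal[OF BBox.prems(2)] by blast
    then have "satK (k, m) (\<^bold>\<sqdot> F) = eK (k, m) (\<^bold>\<sqdot> F)"
      using BBox.prems by (simp add: SK_def del: RK.simps)
    \<comment> \<open>\<open>eK\<close> reads this value from the first model, but linked worlds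
      agree on it as a shared atom.\<close>
    moreover have "satM k (\<^bold>\<sqdot> F) = satN m (\<^bold>\<sqdot> F)" if "\<^bold>\<sqdot> F \<in> closure_of A"
    proof -
      have "\<^bold>\<sqdot> F \<in> shared_atoms A P" using that BBox.prems(1) unfolding shared_atoms_def by auto
      then show ?thesis using bisim_atoms[OF linked_bis[OF BBox.prems(2)]] by blast
    qed
    ultimately show ?thesis unfolding eK_def by (simp del: sat.simps)
  qed
qed auto

lemma model_K: "rosser_model RK eK SK"
  unfolding rosser_model_def
proof (intro conjI allI impI)
  show "transp RK"
  proof (rule transpI)
    fix x y z assume xyz: "RK x y" "RK y z"
    obtain k m l n j i where eq: "x = (k, m)" "y = (l, n)" "z = (j, i)" by (metis surj_pair)
    obtain k' l' where "boxes k \<subseteq> boxes k'" "RM k' l" "boxes l \<subseteq> boxes l'" "RM l' j"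
      using xyz unfolding eq by auto
    moreover have "RN m i" using xyz rosser_model_transD[OF model_N] unfolding eq by auto
    moreover have "boxes k' \<subseteq> boxes l" using \<open>RM k' l\<close> by (rule boxes_mono)
    ultimately show "RK x z" using xyz unfolding eq by auto
  qed
  have "wfp RN\<inverse>\<inverse>" using model_N by (simp add: rosser_model_def)
  then show "wfp RK\<inverse>\<inverse>" by (rule wfp_if_convertible_to_wfp[of _ _ snd]) auto
next
  fix x y D assume "RK x y" and ter: "\<nexists>u. RK y u" and D: "D \<in> SK"
  obtain k m l n where eq: "x = (k, m)" "y = (l, n)" by (metis surj_pair)
  have R: "RK (k, m) (l, n)" using \<open>RK x y\<close> eq by simp
  then obtain k' where k': "boxes k \<subseteq> boxes k'" "RM k' l" by auto
  have ln: "linked k m" "linked l n" "RN m n" using R by auto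
  have eK: "eK y (\<^bold>\<sqdot> D) = satK (l, n) (\<^bold>\<sqdot> D)" using ter D unfolding eq by (simp del: RK.simps)
  have *: "(satK (k, m) (\<^bold>\<box> D) \<longrightarrow> satK (l, n) (\<^bold>\<sqdot> D)) \<and>
      (satK (k, m) (\<^bold>\<box> \<^bold>\<not> D) \<longrightarrow> \<not> satK (l, n) (\<^bold>\<sqdot> D))"
  \<comment> \<open>The constraints are inherited from the model that governs \<open>D\<close>: from
    the first one by way of \<open>k'\<close> and \<open>l\<close>, from the second by way of
    \<open>m\<close> and \<open>n\<close>.\<close>
  proof (cases "\<^bold>\<sqdot> D \<in> closure_of A")
    case True
    then have c: "\<^bold>\<box> D \<in> closure_of A" "\<^bold>\<box> \<^bold>\<not> D \<in> closure_of A"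
      using adequate_BBox[OF adequate_closure_of] by blast+
    then have "satM k (\<^bold>\<box> D) \<longrightarrow> satM k' (\<^bold>\<box> D)" "satM k (\<^bold>\<box> \<^bold>\<not> D) \<longrightarrow> satM k' (\<^bold>\<box> \<^bold>\<not> D)"
      using k'(1) unfolding boxes_def by blast+
    moreover have "satM k' (\<^bold>\<box> D) \<longrightarrow> satM l (\<^bold>\<sqdot> D)" "satM k' (\<^bold>\<box> \<^bold>\<not> D) \<longrightarrow> \<not> satM l (\<^bold>\<sqdot> D)"
      using sat_BBox_if_Box_below[OF model_M k'(2), of D]
        not_sat_BBox_if_Box_Neg_below[OF model_M k'(2), of D] by (simp_all del: sat.simps(6))
    ultimately show ?thesis
      using satK_eq_satM[OF c(1) ln(1)] satK_eq_satM[OF c(2) ln(1)] satK_eq_satM[OF True ln(2)] by blast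
  next
    case False
    then have v: "vars (\<^bold>\<box> D) \<inter> P = {}" "vars (\<^bold>\<box> \<^bold>\<not> D) \<inter> P = {}" "vars (\<^bold>\<sqdot> D) \<inter> P = {}"
      using D unfolding SK_def by auto
    have "satN m (\<^bold>\<box> D) \<longrightarrow> satN n (\<^bold>\<sqdot> D)" "satN m (\<^bold>\<box> \<^bold>\<not> D) \<longrightarrow> \<not> satN n (\<^bold>\<sqdot> D)"
      using sat_BBox_if_Box_below[OF model_N ln(3), of D]
        not_sat_BBox_if_Box_Neg_below[OF model_N ln(3), of D] by (simp_all del: sat.simps(6))
    then show ?thesis
      using satK_eq_satN[OF v(1) ln(1)] satK_eq_satN[OF v(2) ln(1)] satK_eq_satN[OF v(3) ln(2)] by blast
  qed
  show "eK y (\<^bold>\<sqdot> D)" if "\<forall>v. RK x v \<longrightarrow> satK v D"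
    using * that unfolding eK unfolding eq by (simp del: RK.simps sat.simps(6))
  show "\<not> eK y (\<^bold>\<sqdot> D)" if "\<forall>v. RK x v \<longrightarrow> \<not> satK v D"
    using * that unfolding eK unfolding eq by (simp del: RK.simps sat.simps(6))
qed

end

text \<open>The rank never exceeds the size of the closure, so a single depth, depending on
  \<open>A\<close> alone, serves all models.\<close>

lemma amalgamate:
  fixes w :: 'm and v :: 'n
  assumes "rosser_model R e S" "rosser_model R' e' S'"
    and bis: "bisim (shared_atoms A P) R (sat R e S) R' (sat R' e' S') n w v"
    and n: "2 * card (closure_of A) + 1 \<le> n" and "sat R e S w A"
  obtains R'' e'' S'' and x :: "'m \<times> 'n" where "rosser_model R'' e'' S''" "sat R'' e'' S'' x A"
    "\<forall>B. vars B \<inter> P = {} \<longrightarrow> sat R'' e'' S'' x B = sat R' e' S' v B"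
proof -
  interpret amalgamation R e S R' e' S' A P using assms(1,2) by unfold_locales
  have "rank w \<le> card (closure_of A)"
    unfolding rank_def by (intro card_mono) (auto intro: adequate_finite adequate_closure_of)
  then have "linked w v" using n by (intro linked_if_bis bisim_lower[OF bis]) simp
  then show thesis
    using that[OF model_K, of "(w, v)"] satK_eq_satM[OF closure_of_self] satK_eq_satN assms(5) by blast
qed

section \<open>The uniform interpolant\<close>

theorem theorem6p4:
  fixes A :: fm and P :: "nat set"
  assumes "finite P"
  shows "\<exists>C. vars C \<subseteq> vars A - P
           \<and> GR\<^sup>- \<turnstile> A \<^bold>\<longrightarrow> C
           \<and> (\<forall>B. GR\<^sup>- \<turnstile> A \<^bold>\<longrightarrow> B \<and> vars B \<inter> P = {} \<longrightarrow> GR\<^sup>- \<turnstile> C \<^bold>\<longrightarrow> B)"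
proof -
  define Q where "Q = shared_atoms A P"
  define n where "n = 2 * card (closure_of A) + 1"
  \<comment> \<open>Infinitely many models may contribute, yet \<open>X\<close> is finite as a part
    of \<open>characteristics Q n\<close>.\<close>
  define X where "X = {characteristic Q R (sat R e S) n w |R e S (w :: fm set).
    rosser_model R e S \<and> sat R e S w A}"
  have finQ: "finite Q" unfolding Q_def by (rule finite_shared_atoms)
  have X: "X \<subseteq> characteristics Q n" unfolding X_def by (auto simp: characteristic_in)
  then have finX: "finite X" using finite_characteristics[OF finQ] finite_subset by blast
  have "vars (Disj X) \<subseteq> vars A - P"
    using X vars_characteristics[OF finQ] vars_shared_atoms[of _ A P]
    unfolding vars_Disj[OF finX] Q_def by blast
  moreover have "GR\<^sup>- \<turnstile> A \<^bold>\<longrightarrow> Disj X"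
  proof (rule ccontr)
    assume "\<not> GR\<^sup>- \<turnstile> A \<^bold>\<longrightarrow> Disj X"
    then obtain R e S and w :: "fm set"
      where M: "rosser_model R e S" "\<not> sat R e S w (A \<^bold>\<longrightarrow> Disj X)" by (rule completeness)
    then have "characteristic Q R (sat R e S) n w \<in> X" unfolding X_def by auto
    then have "sat R e S w (Disj X)"
      unfolding sat_Disj[OF finX] by (rule bexI[rotated]) (rule sat_own_characteristic[OF finQ])
    then show False using M(2) by simp
  qed
  moreover have "GR\<^sup>- \<turnstile> Disj X \<^bold>\<longrightarrow> B" if B: "GR\<^sup>- \<turnstile> A \<^bold>\<longrightarrow> B" "vars B \<inter> P = {}" for B
  proof (rule ccontr)
    assume "\<not> GR\<^sup>- \<turnstile> Disj X \<^bold>\<longrightarrow> B"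
    then obtain R' e' S' and v :: "fm set"
      where N: "rosser_model R' e' S'" "\<not> sat R' e' S' v (Disj X \<^bold>\<longrightarrow> B)" by (rule completeness)
    then obtain F where "F \<in> X" "sat R' e' S' v F" using sat_Disj[OF finX, of R' e' S' v] by auto
    \<comment> \<open>Membership of \<open>F\<close> in \<open>X\<close> produces a model of
      \<open>A\<close> whose characteristic formula holds at \<open>v\<close>.\<close>
    then obtain R e S and w :: "fm set" where M: "rosser_model R e S" "sat R e S w A"
      and char: "sat R' e' S' v (characteristic Q R (sat R e S) n w)"
      unfolding X_def by blast
    have bis: "bisim Q R (sat R e S) R' (sat R' e' S') n w v"
      using char by (rule bisim_if_sat_characteristic[OF finQ])
    obtain R'' e'' S'' and x :: "fm set \<times> fm set" where K: "rosser_model R'' e'' S''"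
      "sat R'' e'' S'' x A" "\<forall>B. vars B \<inter> P = {} \<longrightarrow> sat R'' e'' S'' x B = sat R' e' S' v B"
      by (rule amalgamate[OF M(1) N(1) bis[unfolded Q_def] eq_refl[OF n_def[symmetric]] M(2)])
    \<comment> \<open>By soundness \<open>B\<close> holds at \<open>x\<close> along with
      \<open>A\<close>; being free of \<open>P\<close>, it then holds at \<open>v\<close>, where it
      was assumed to fail.\<close>
    then show False using soundness[OF B(1) K(1), of x] N(2) B(2) by simp
  qed
  ultimately show ?thesis by blast
qed

end
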